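(* Let $(G,\beta)$ be an edge-labeled graph on vertices $v_1,\dots,v_n$, with module $m_i\mathbb{Z}$ at $v_i$ and module $\mathbb{Z}/r_{ij}\mathbb{Z}$ at each edge $v_iv_j$, and let $\mathcal{P}^1$ be the set of the longest paths of $v_1$. For each longest path $P_k\in\mathcal{P}^1$ (a path from some $v_j$ to $v_1$), let $F_k$ be a minimal spline, with nonzero entry $f_{kv_1}\neq0$ at $v_1$, on the edge-labeled path graph $(P_k,\beta|_{P_k})$. Then there exists a flow-up class $F^{(1)}=(f^{(1)}_{v_1},f^{(1)}_{v_2},\dots,f^{(1)}_{v_n})$ on $(G,\beta)$ whose first nonzero entry $f^{(1)}_{v_1}$ is equal to the least common multiple of all the $f_{kv_1}$.
   Context: Setting: $G$ is a finite graph with ordered vertex set $\{v_1,\dots,v_n\}$, whose edges are unordered pairs of distinct vertices. Each vertex $v_i$ carries the $\mathbb{Z}$-module $m_i\mathbb{Z}$ ($m_i\in\mathbb{Z}$) and each edge $v_iv_j$ the $\mathbb{Z}$-module $\beta(v_iv_j)=\mathbb{Z}/r_{ij}\mathbb{Z}$ ($r_{ij}=r_{ji}\in\mathbb{Z}$). A spline on $(G,\beta)$ is a tuple of integers $(f_{v_1},\dots,f_{v_n})$ with $f_{v_i}\in m_i\mathbb{Z}$ for all $i$ and $f_{v_i}\equiv f_{v_j}\pmod{r_{ij}}$ for every edge $v_iv_j$. An $i$-th flow-up class is a spline with $f_{v_i}\ne0$ and $f_{v_s}=0$ for $s<i$. Longest paths: a trail from $v_j$ to $v_i$ is an ordered sequence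 of vertices and edges from $v_j$ to $v_i$ with no repeated edge, regarded as a path graph (so its vertices are distinct). A longest path of $v_i$ is a trail ending at $v_i$ (starting from any vertex) that is maximal under strict inclusion among all trails ending at $v_i$, i.e. it is not strictly contained in another trail ending at $v_i$. (If $v_i$ is isolated, the only one is the trivial path consisting of $v_i$.) Minimal spline on a longest path $P$ of $v_i$: order the vertices of $P$ starting from its end $v_i$. $P$ is an edge-labeled graph with the vertex modules and edge labels inherited from $(G,\beta)$. A spline on $P$ with nonzero entry at $v_i$ is minimal if its entry at $v_i$ generates the ideal of $\mathbb{Z}$ consisting of all entries at $v_i$ of splines on $P$. *)

theory Defs
  imports Main "HOL-Number_Theory.Cong"
begin

(* The list carries the ordering v_1, ..., v_n of the vertices. The vertex v carries the module
   (vlabel v)Z and the edge e the module Z/(elabel e)Z; labels may be zero or negative. As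
   elabel takes the unordered edge {u, v}, the condition r_ij = r_ji holds automatically. *)
record 'a labeled_graph =
  vertices :: "'a list"
  edges :: "'a set set"
  vlabel :: "'a \<Rightarrow> int"
  elabel :: "'a set \<Rightarrow> int"

definition edge_labeled_graph :: "'a labeled_graph \<Rightarrow> bool" where
  "edge_labeled_graph G \<longleftrightarrow>
     distinct (vertices G) \<and>
     edges G \<subseteq> {{u, v} |u v. u \<in> set (vertices G) \<and> v \<in> set (vertices G) \<and> u \<noteq> v}"

(* Vertices are numbered from 1. *)
definition vertex :: "'a labeled_graph \<Rightarrow> nat \<Rightarrow> 'a" where
  "vertex G i = vertices G ! (i - 1)"

(* Only the values of f on the vertices of G matter. Congruence modulo 0 is equality. *)
definition spline :: "'a labeled_graph \<Rightarrow> ('a \<Rightarrow> int) \<Rightarrow> bool" where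
  "spline G f \<longleftrightarrow>
     (\<forall>v\<in>set (vertices G). vlabel G v dvd f v) \<and>
     (\<forall>u v. {u, v} \<in> edges G \<longrightarrow> [f u = f v] (mod elabel G {u, v}))"

definition flow_up_class :: "'a labeled_graph \<Rightarrow> nat \<Rightarrow> ('a \<Rightarrow> int) \<Rightarrow> bool" where
  "flow_up_class G i f \<longleftrightarrow>
     1 \<le> i \<and> i \<le> length (vertices G) \<and> spline G f \<and>
     f (vertex G i) \<noteq> 0 \<and> (\<forall>s. 1 \<le> s \<and> s < i \<longrightarrow> f (vertex G s) = 0)"

definition path_edges :: "'a list \<Rightarrow> 'a set set" where
  "path_edges p = {{p ! i, p ! Suc i} |i. Suc i < length p}"

(* A trail is given by its list of vertices, which determines its edges since there are no
   multiple edges. Its vertices are distinct, hence no edge is repeated. *)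
definition trail_ending_at :: "'a labeled_graph \<Rightarrow> 'a \<Rightarrow> 'a list \<Rightarrow> bool" where
  "trail_ending_at G v p \<longleftrightarrow>
     p \<noteq> [] \<and> last p = v \<and> distinct p \<and> set p \<subseteq> set (vertices G) \<and> path_edges p \<subseteq> edges G"

(* Containment of trails as path graphs. *)
definition trail_contained :: "'a list \<Rightarrow> 'a list \<Rightarrow> bool" where
  "trail_contained p q \<longleftrightarrow> set p \<subseteq> set q \<and> path_edges p \<subseteq> path_edges q"

definition trail_strictly_contained :: "'a list \<Rightarrow> 'a list \<Rightarrow> bool" where
  "trail_strictly_contained p q \<longleftrightarrow> trail_contained p q \<and> \<not> trail_contained q p"

definition longest_paths :: "'a labeled_graph \<Rightarrow> 'a \<Rightarrow> 'a list set" where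
  "longest_paths G v =
     {p. trail_ending_at G v p \<and>
         \<not> (\<exists>q. trail_ending_at G v q \<and> trail_strictly_contained p q)}"

(* The list is reversed because the vertices are ordered starting from the end of the trail. *)
definition path_graph :: "'a labeled_graph \<Rightarrow> 'a list \<Rightarrow> 'a labeled_graph" where
  "path_graph G p = G\<lparr>vertices := rev p, edges := path_edges p\<rparr>"

(* The right-hand side of the last equation is the ideal generated by f v. *)
definition minimal_spline :: "'a labeled_graph \<Rightarrow> 'a \<Rightarrow> ('a \<Rightarrow> int) \<Rightarrow> bool" where
  "minimal_spline P v f \<longleftrightarrow>
     spline P f \<and> f v \<noteq> 0 \<and> {g v |g. spline P g} = {k * f v |k. True}"

end

theory Submission
  imports Defs
begin

text \<open>
  Let \<open>a\<close> be the least common multiple. Every trail lies on a longest path and splines restrict and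
  scale, so every trail ending at \<open>v\<^sub>1\<close> carries a spline with entry \<open>a\<close> at \<open>v\<^sub>1\<close>. For a prime \<open>q\<close>
  let \<open>D q\<close> be the least power of \<open>q\<close> that does not divide \<open>a\<close>. If a trail from \<open>v\<close> to \<open>v\<^sub>1\<close> has all
  edge labels divisible by \<open>D q\<close>, its spline is congruent to \<open>a\<close> modulo \<open>D q\<close> at \<open>v\<close>, so \<open>D q\<close> does
  not divide the label of \<open>v\<close>. Hence, locally at \<open>q\<close>, the function that is \<open>a\<close> at the vertices
  reached by such trails and \<open>0\<close> elsewhere is a spline on \<open>G\<close>. These local solutions are glued by the
  Chinese remainder theorem: the entry at \<open>v\<close> is \<open>a\<close> times an integer that depends only on the set
  of primes at which \<open>v\<close> is reached, which makes entries agree exactly along edges labeled \<open>0\<close>.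
\<close>

section \<open>Paths and congruences along them\<close>

lemma path_edges_singleton [simp]: "path_edges [x] = {}"
  by (simp add: path_edges_def)

lemma path_edges_Cons_Cons [simp]:
  "path_edges (x # y # p) = insert {x, y} (path_edges (y # p))"
proof (intro equalityI subsetI)
  fix e assume "e \<in> path_edges (x # y # p)"
  then obtain i where "Suc i < length (x # y # p)"
    and "e = {(x # y # p) ! i, (x # y # p) ! Suc i}"
    unfolding path_edges_def by blast
  then show "e \<in> insert {x, y} (path_edges (y # p))"
    by (cases i) (auto simp: path_edges_def)
next
  fix e assume "e \<in> insert {x, y} (path_edges (y # p))"
  then consider "e = {x, y}"
    | i where "Suc i < length (y # p)" "e = {(y # p) ! i, (y # p) ! Suc i}"
    unfolding path_edges_def by blast
  then show "e \<in> path_edges (x # y # p)"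
  proof cases
    case 1
    then show ?thesis unfolding path_edges_def by (auto intro!: exI[of _ 0])
  next
    case 2
    then show ?thesis unfolding path_edges_def by (auto intro!: exI[of _ "Suc i"])
  qed
qed

lemma path_edges_append_right: "path_edges q \<subseteq> path_edges (p @ q)"
proof
  fix e assume "e \<in> path_edges q"
  then obtain i where "Suc i < length q" "e = {q ! i, q ! Suc i}"
    unfolding path_edges_def by blast
  then have "Suc (length p + i) < length (p @ q)"
    "e = {(p @ q) ! (length p + i), (p @ q) ! Suc (length p + i)}"
    by (simp_all add: nth_append)
  then show "e \<in> path_edges (p @ q)" unfolding path_edges_def by blast
qed

lemma cong_along_path:
  assumes "p \<noteq> []" and "\<And>u v. {u, v} \<in> path_edges p \<Longrightarrow> [g u = g v] (mod d)"
  shows "[g (hd p) = g (last p)] (mod d)"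
  using assms
proof (induction p rule: induct_list012)
  case (3 x y p)
  have "[g x = g y] (mod d)"
    using "3.prems" by simp
  moreover have "[g (hd (y # p)) = g (last (y # p))] (mod d)"
    using "3.prems" by (intro "3.IH") auto
  ultimately show ?case
    using cong_trans by auto
qed auto

section \<open>Longest paths and extension of trails\<close>

lemma finite_edges: "edge_labeled_graph G \<Longrightarrow> finite (edges G)"
  unfolding edge_labeled_graph_def
  by (rule finite_subset[of _ "Pow (set (vertices G))"]) auto

lemma finite_longest_paths: "finite (longest_paths G v)"
  by (rule finite_subset[OF _ finite_subset_distinct[of "set (vertices G)"]])
    (auto simp: longest_paths_def trail_ending_at_def)

text \<open>Since \<open>G\<close> is finite, some trail containing \<open>p\<close> has the largest
  number of vertices plus edges. A trail strictly containing that one would raise this number, so it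
  is a longest path.\<close>

lemma trail_contained_longest_path:
  assumes "edge_labeled_graph G" and "trail_ending_at G v p"
  shows "\<exists>q\<in>longest_paths G v. trail_contained p q"
proof -
  let ?P = "\<lambda>q. trail_ending_at G v q \<and> trail_contained p q"
  let ?size = "\<lambda>q. card (set q) + card (path_edges q)"
  have bound: "?size q < Suc (card (set (vertices G)) + card (edges G))" if "?P q" for q
    using that finite_edges[OF assms(1)] unfolding trail_ending_at_def
    by (intro le_imp_less_Suc add_mono card_mono) auto
  have "?P p"
    using assms(2) by (simp add: trail_contained_def)
  then have "\<exists>q. ?P q \<and> (\<forall>q'. ?P q' \<longrightarrow> ?size q' \<le> ?size q)"
    using bound
    by (intro ex_has_greatest_nat[of ?P p ?size "Suc (card (set (vertices G)) + card (edges G))"])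
      simp_all
  then obtain q where q: "?P q" and max: "\<And>q'. ?P q' \<Longrightarrow> ?size q' \<le> ?size q"
    by blast
  have "\<not> trail_strictly_contained q q'" if q': "trail_ending_at G v q'" for q'
  proof
    assume strict: "trail_strictly_contained q q'"
    then have sub: "set q \<subseteq> set q'" "path_edges q \<subseteq> path_edges q'"
      and nsub: "set q \<noteq> set q' \<or> path_edges q \<noteq> path_edges q'"
      by (auto simp: trail_strictly_contained_def trail_contained_def)
    have fin: "finite (path_edges q')"
      using q' finite_edges[OF assms(1)] finite_subset unfolding trail_ending_at_def by blast
    have "?P q'"
      using q q' sub by (auto simp: trail_contained_def)
    then have "?size q' \<le> ?size q"
      by (rule max)
    moreover have "card (set q) \<le> card (set q')" "card (path_edges q) \<le> card (path_edges q')"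
      using sub fin by (auto intro: card_mono)
    ultimately have "card (set q) = card (set q')" "card (path_edges q) = card (path_edges q')"
      by linarith+
    then have "set q = set q'" "path_edges q = path_edges q'"
      using sub fin by (simp_all add: card_subset_eq)
    with nsub show False by simp
  qed
  then have "q \<in> longest_paths G v"
    using q by (simp add: longest_paths_def)
  with q show ?thesis by (intro bexI[of _ q]) simp_all
qed

lemma spline_path_graph_mono:
  "spline (path_graph G q) g \<Longrightarrow> trail_contained p q \<Longrightarrow> spline (path_graph G p) g"
  unfolding spline_def path_graph_def trail_contained_def by auto

lemma spline_scale: "spline G g \<Longrightarrow> spline G (\<lambda>v. c * g v)"
  unfolding spline_def by (auto intro: cong_scalar_left)

text \<open>Prepending \<open>y\<close> could repeat a vertex. If \<open>y\<close> already lies on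
  \<open>p\<close>, the part of \<open>p\<close> from \<open>y\<close> onwards serves instead, and
  it uses only edges of \<open>p\<close>.\<close>

lemma trail_extend:
  assumes "edge_labeled_graph G" and "trail_ending_at G v p" and "{hd p, y} \<in> edges G"
  obtains q where "trail_ending_at G v q" and "hd q = y"
    and "path_edges q \<subseteq> insert {hd p, y} (path_edges p)"
proof (cases "y \<in> set p")
  case True
  then obtain xs ys where p: "p = xs @ y # ys"
    by (meson split_list)
  have "path_edges (y # ys) \<subseteq> path_edges p"
    unfolding p by (rule path_edges_append_right)
  moreover from this have "trail_ending_at G v (y # ys)"
    using assms(2) unfolding trail_ending_at_def p by auto
  ultimately show thesis
    using that[of "y # ys"] by auto
next
  case False
  obtain x xs where p: "p = x # xs"
    using assms(2) by (cases p) (auto simp: trail_ending_at_def)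
  have "y \<in> set (vertices G)"
    using assms(1,3) unfolding edge_labeled_graph_def by (fastforce simp: doubleton_eq_iff)
  then have "trail_ending_at G v (y # p)"
    using assms(2,3) False unfolding trail_ending_at_def p by (auto simp: insert_commute)
  then show thesis
    using that[of "y # p"] by (auto simp: p insert_commute)
qed

section \<open>Interpolation over primes\<close>

text \<open>For nonzero \<open>w\<close>, such an \<open>e\<close> represents the idempotent of the
  ring of integers modulo \<open>w\<close> that is 1 in the components at primes of \<open>S\<close>
  and 0 in the others.\<close>

definition prime_indicator :: "int \<Rightarrow> int set \<Rightarrow> int \<Rightarrow> bool" where
  "prime_indicator w S e \<longleftrightarrow>
     (\<forall>q. prime q \<longrightarrow> q ^ multiplicity q w dvd (if q \<in> S then e - 1 else e))"

text \<open>The part of \<open>w\<close> at primes in \<open>S\<close> and the part at the remaining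
  primes are coprime, so the Chinese remainder theorem applies to the residues 1 and 0.\<close>

lemma ex_prime_indicator:
  assumes "w \<noteq> 0"
  shows "\<exists>e. prime_indicator w S e"
proof -
  define part where "part T = (\<Prod>q\<in>prime_factors w \<inter> T. q ^ multiplicity q w)" for T
  have part: "q ^ multiplicity q w dvd part T" if "prime q" "q \<in> T" for q T
  proof (cases "q dvd w")
    case True
    then show ?thesis
      using that assms unfolding part_def
      by (intro dvd_prodI) (auto simp: prime_factors_dvd)
  next
    case False
    then show ?thesis
      by (simp add: not_dvd_imp_multiplicity_0)
  qed
  have "coprime (part S) (part (- S))"
    unfolding part_def
    by (intro prod_coprime_left prod_coprime_right coprime_power_left_iff[THEN iffD2]
        coprime_power_right_iff[THEN iffD2] disjI1 primes_coprime) auto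
  then obtain e where e: "[e = 1] (mod part S)" "[e = 0] (mod part (- S))"
    using binary_chinese_remainder_int[of "part S" "part (- S)" 1 0] by blast
  have "q ^ multiplicity q w dvd (if q \<in> S then e - 1 else e)" if "prime q" for q
    using e part[OF that] by (auto simp: cong_iff_dvd_diff intro: dvd_trans)
  then show ?thesis
    unfolding prime_indicator_def by blast
qed

text \<open>Multiplicities are compared at each prime: either \<open>a\<close> alone contains the
  power of \<open>q\<close> in \<open>x\<close>, or \<open>e\<close> contains the power of
  \<open>q\<close> in \<open>w\<close>, which is at least that in \<open>x\<close>.\<close>

lemma dvd_mult_by_prime_powers:
  fixes a x e w :: int
  assumes "x \<noteq> 0" "a \<noteq> 0" "w \<noteq> 0" "x dvd w"
    and "\<And>q. prime q \<Longrightarrow> q ^ Suc (multiplicity q a) dvd x \<Longrightarrow> q ^ multiplicity q w dvd e"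
  shows "x dvd a * e"
proof (cases "e = 0")
  case False
  show ?thesis
  proof (rule multiplicity_le_imp_dvd)
    fix q :: int assume q: "prime q"
    have mult: "multiplicity q (a * e) = multiplicity q a + multiplicity q e"
      using q False assms(2) by (intro prime_elem_multiplicity_mult_distrib) auto
    show "multiplicity q x \<le> multiplicity q (a * e)"
    proof (cases "q ^ Suc (multiplicity q a) dvd x")
      case True
      then have "multiplicity q w \<le> multiplicity q e"
        using assms(5)[OF q] False q by (intro multiplicity_geI) auto
      moreover have "multiplicity q x \<le> multiplicity q w"
        using assms by (simp add: dvd_imp_multiplicity_le)
      ultimately show ?thesis
        using mult by linarith
    next
      case False
      then have "multiplicity q x < Suc (multiplicity q a)"
        using multiplicity_dvd' not_less by blast
      then show ?thesis
        using mult by linarith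
    qed
  qed (use assms in auto)
qed simp

theorem theorem6p11:
  fixes G :: "'a labeled_graph" and F :: "'a list \<Rightarrow> 'a \<Rightarrow> int"
  assumes "edge_labeled_graph G"
    and "vertices G \<noteq> []"
    and "\<And>P. P \<in> longest_paths G (vertex G 1) \<Longrightarrow>
           minimal_spline (path_graph G P) (vertex G 1) (F P)"
  shows "\<exists>f. flow_up_class G 1 f \<and>
           f (vertex G 1) = Lcm {F P (vertex G 1) |P. P \<in> longest_paths G (vertex G 1)}"
proof -
  define v1 where "v1 = vertex G 1"
  define a where "a = Lcm {F P v1 |P. P \<in> longest_paths G v1}"
  have v1: "v1 \<in> set (vertices G)"
    using assms(2) by (simp add: v1_def vertex_def)
  have minimal: "spline (path_graph G P) (F P)" "F P v1 \<noteq> 0" if "P \<in> longest_paths G v1" for P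
    using assms(3) that unfolding v1_def minimal_spline_def by auto
  \<comment> \<open>Finiteness matters here: the \<open>Lcm\<close> of an infinite set of integers
    is 0.\<close>
  have "finite {F P v1 |P. P \<in> longest_paths G v1}"
    using finite_imageI[OF finite_longest_paths, of "\<lambda>P. F P v1"] by (simp add: setcompr_eq_image)
  then have a0: "a \<noteq> 0"
    using minimal(2) unfolding a_def by (subst Lcm_0_iff) auto
  have trail_spline: "\<exists>g. spline (path_graph G p) g \<and> g v1 = a" if p: "trail_ending_at G v1 p" for p
  proof -
    obtain q where q: "q \<in> longest_paths G v1" "trail_contained p q"
      using trail_contained_longest_path[OF assms(1) p] by blast
    have "F q v1 dvd a"
      using q(1) unfolding a_def by (intro dvd_Lcm) auto
    then obtain c where "a = c * F q v1"
      by (metis dvd_def mult.commute)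
    then show ?thesis
      using spline_scale[OF spline_path_graph_mono[OF minimal(1)[OF q(1)] q(2)], of c] by auto
  qed

  define D where "D q = q ^ Suc (multiplicity q a)" for q :: int

  \<comment> \<open>Reachability at a prime\<close>
  \<comment> \<open>This is the connected component of \<open>v1\<close> in the subgraph of the
    edges whose label \<open>D q\<close> divides. Edges labeled 0 belong to this subgraph for every
    \<open>q\<close>.\<close>
  define reached where "reached q x \<longleftrightarrow>
    (\<exists>p. trail_ending_at G v1 p \<and> hd p = x \<and> (\<forall>e\<in>path_edges p. D q dvd elabel G e))" for q x
  define S where "S x = {q. prime q \<and> reached q x}" for x
  have D_a: "\<not> D q dvd a" if "prime q" for q
    using that a0 multiplicity_geI[of a q "Suc (multiplicity q a)"] by (auto simp: D_def)
  have reached_label: "\<not> D q dvd vlabel G x" if q: "prime q" "reached q x" for q x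
  proof
    assume dvd: "D q dvd vlabel G x"
    obtain p where p: "trail_ending_at G v1 p" "hd p = x"
      "\<And>e. e \<in> path_edges p \<Longrightarrow> D q dvd elabel G e"
      using q(2) unfolding reached_def by blast
    obtain g where g: "spline (path_graph G p) g" "g v1 = a"
      using trail_spline[OF p(1)] by blast
    have ne: "p \<noteq> []" "last p = v1"
      using p(1) by (auto simp: trail_ending_at_def)
    have "[g u = g v] (mod D q)" if "{u, v} \<in> path_edges p" for u v
    proof (rule cong_dvd_modulus)
      show "[g u = g v] (mod elabel G {u, v})"
        using g(1) that by (simp add: spline_def path_graph_def)
      show "D q dvd elabel G {u, v}"
        using that by (rule p(3))
    qed
    with ne(1) have "[g (hd p) = g (last p)] (mod D q)"
      by (rule cong_along_path)
    moreover have "D q dvd g (hd p)"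
      using dvd g(1) p(2) ne(1) by (auto simp: spline_def path_graph_def intro: dvd_trans)
    ultimately have "D q dvd a"
      using g(2) ne(2) by (simp add: cong_dvd_iff)
    with D_a[OF q(1)] show False ..
  qed
  have reached_step: "reached q y"
    if xy: "reached q x" "{x, y} \<in> edges G" "D q dvd elabel G {x, y}" for q x y
  proof -
    obtain p where p: "trail_ending_at G v1 p" "hd p = x" "\<forall>e\<in>path_edges p. D q dvd elabel G e"
      using xy(1) unfolding reached_def by blast
    obtain p' where "trail_ending_at G v1 p'" "hd p' = y"
      "path_edges p' \<subseteq> insert {x, y} (path_edges p)"
      using trail_extend[OF assms(1) p(1)] p(2) xy(2) by metis
    then show ?thesis
      using p(3) xy(3) unfolding reached_def by (intro exI[of _ p']) auto
  qed
  have reached_iff: "q \<in> S x \<longleftrightarrow> q \<in> S y"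
    if "{x, y} \<in> edges G" "D q dvd elabel G {x, y}" for q x y
    using reached_step[of q x y] reached_step[of q y x] that
    by (auto simp: S_def insert_commute)
  \<comment> \<open>The trivial trail \<open>[v1]\<close> has no edges, so it reaches
    \<open>v1\<close> at every prime.\<close>
  have S_v1: "S v1 = {q. prime q}"
    using v1 by (auto simp: S_def reached_def trail_ending_at_def intro!: exI[of _ "[v1]"])

  \<comment> \<open>Gluing the local solutions\<close>
  define X where "X = (vlabel G ` set (vertices G) \<union> elabel G ` edges G) - {0}"
  \<comment> \<open>A common multiple of all nonzero labels. Labels equal to 0 are left out to keep
    \<open>w\<close> nonzero; they impose exact equations, which are treated separately.\<close>
  define w where "w = \<Prod>X"
  have finX: "finite X"
    using finite_edges[OF assms(1)] by (simp add: X_def)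
  have w0: "w \<noteq> 0"
    using finX by (simp add: w_def X_def)
  have dvd_w: "x dvd w" if "x \<in> X" for x
    using finX that unfolding w_def by (rule dvd_prodI)
  \<comment> \<open>The two special values are fixed exactly, not just modulo \<open>w\<close>: 0
    gives the entry 0 at vertices labeled 0, and 1 gives the entry \<open>a\<close> at
    \<open>v1\<close>.\<close>
  define E where "E T = (if T = {} then 0 else if T = {q. prime q} then 1
    else SOME e. prime_indicator w T e)" for T
  have E: "prime_indicator w T (E T)" for T
  proof -
    consider "T = {}" | "T = {q. prime q}" | "E T = (SOME e. prime_indicator w T e)"
      unfolding E_def by presburger
    then show ?thesis
    proof cases
      case 3
      then show ?thesis
        using someI_ex[OF ex_prime_indicator[OF w0]] by simp
    qed (auto simp: E_def prime_indicator_def)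
  qed
  then have E_dvd: "q ^ multiplicity q w dvd (if q \<in> T then E T - 1 else E T)"
    if "prime q" for q T
    using that unfolding prime_indicator_def by blast
  define f where "f x = a * E (S x)" for x

  \<comment> \<open>A prime exists, so the set of all primes falls under the second case of
    \<open>E\<close> and not the first.\<close>
  have "prime (2 :: int)" by simp
  then have "{q :: int. prime q} \<noteq> {}" by blast
  then have f_v1: "f v1 = a"
    by (auto simp: f_def E_def S_v1)
  have "vlabel G x dvd f x" if x: "x \<in> set (vertices G)" for x
  proof (cases "vlabel G x = 0")
    case True
    \<comment> \<open>Every \<open>D q\<close> divides the label 0, whereas \<open>D q\<close> never
      divides the label of a vertex reached at \<open>q\<close>.\<close>
    then have "S x = {}"
      using reached_label[of _ x] by (auto simp: S_def)
    then show ?thesis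
      by (simp add: f_def E_def)
  next
    case False
    show ?thesis
      unfolding f_def
    proof (rule dvd_mult_by_prime_powers[OF False a0 w0])
      show "vlabel G x dvd w"
        using False x by (intro dvd_w) (auto simp: X_def)
      fix q :: int assume "prime q" "q ^ Suc (multiplicity q a) dvd vlabel G x"
      then have "q \<notin> S x"
        using reached_label[of q x] by (auto simp: S_def D_def)
      then show "q ^ multiplicity q w dvd E (S x)"
        using E_dvd[OF \<open>prime q\<close>, of "S x"] by simp
    qed
  qed
  moreover have "[f x = f y] (mod elabel G {x, y})" if xy: "{x, y} \<in> edges G" for x y
  proof (cases "elabel G {x, y} = 0")
    case True
    \<comment> \<open>Every \<open>D q\<close> divides 0, so both ends are reached at the same
      primes and receive the same value of \<open>E\<close>.\<close>
    then have "S x = S y"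
      using reached_iff[OF xy] by auto
    then show ?thesis
      by (simp add: f_def)
  next
    case False
    have "elabel G {x, y} dvd a * (E (S x) - E (S y))"
    proof (rule dvd_mult_by_prime_powers[OF False a0 w0])
      show "elabel G {x, y} dvd w"
        using False xy by (intro dvd_w) (auto simp: X_def)
      fix q :: int assume q: "prime q" "q ^ Suc (multiplicity q a) dvd elabel G {x, y}"
      then have "q \<in> S x \<longleftrightarrow> q \<in> S y"
        using reached_iff[OF xy] by (simp add: D_def)
      \<comment> \<open>Modulo this power of \<open>q\<close>, both values are 1 or both are
        0.\<close>
      then show "q ^ multiplicity q w dvd E (S x) - E (S y)"
        using dvd_diff[OF E_dvd[OF q(1), of "S x"] E_dvd[OF q(1), of "S y"]]
        by (cases "q \<in> S x") simp_all
    qed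
    then show ?thesis
      by (simp add: f_def cong_iff_dvd_diff right_diff_distrib)
  qed
  ultimately have "spline G f"
    by (simp add: spline_def)
  then have "flow_up_class G 1 f"
    using assms(2) f_v1 a0 unfolding flow_up_class_def v1_def
    by (auto simp: Suc_le_eq)
  then show ?thesis
    using f_v1 unfolding a_def v1_def by blast
qed

end
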